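(* Let $\mu$ be the Cantor–Lebesgue middle-thirds measure on $[0,1)$. Then there is no injective $B\in B(L^2(\mu))$ such that $\{Be^{2\pi i nx}\}_{n=0}^{\infty}\subseteq L^2(\mu)$ is a Bessel sequence.
   Context: $B(\mathcal{H})$ is the space of bounded linear operators on a Hilbert space $\mathcal{H}$. A sequence $\{f_n\}$ in $\mathcal{H}$ is a Bessel sequence if there is $C>0$ with $\sum_n|\langle f,f_n\rangle|^2\le C\|f\|^2$ for all $f\in\mathcal{H}$. $L^2(\mu)$ is the complex $L^2$ space with $\langle f,h\rangle=\int f\overline{h}\,d\mu$. The Cantor–Lebesgue middle-thirds measure is the Borel probability measure whose distribution function is the Cantor function, i.e. the law of $\sum_{k\ge1}2\varepsilon_k3^{-k}$ with $\varepsilon_k$ independent and uniform on $\{0,1\}$ (viewed on $[0,1)$, since $\{1\}$ has measure zero). *)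

theory Defs
  imports "HOL-Probability.Probability"
begin

text \<open>
  The sum starts at index 0, so the digit with index k carries the weight
  2 / 3^(k+1). The law charges only [0,1] and gives the point 1 mass zero,
  so restricting it to [0,1) loses no mass.
\<close>

definition cantor_law :: "real measure" where
  "cantor_law =
     distr (PiM UNIV (\<lambda>_::nat. measure_pmf (pmf_of_set {0, 1::real}))) borel
       (\<lambda>\<epsilon>. \<Sum>k. 2 * \<epsilon> k / 3 ^ Suc k)"

definition cantor_measure :: "real measure" where
  "cantor_measure = restrict_space cantor_law {0..<1}"

text \<open>
  Elements of the complex space L2(M) are handled through representatives: square-integrable
  functions, with equality of elements expressed as equality almost everywhere.
  An operator on L2(M) is accordingly a map on representatives that respects
  equality almost everywhere, and its linearity and injectivity are those of the
  induced map on classes. Its values at functions outside L2(M) play no role.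
\<close>

definition L2 :: "'a measure \<Rightarrow> ('a \<Rightarrow> complex) set" where
  "L2 M = {f \<in> borel_measurable M. integrable M (\<lambda>x. (cmod (f x))\<^sup>2)}"

definition L2_inner :: "'a measure \<Rightarrow> ('a \<Rightarrow> complex) \<Rightarrow> ('a \<Rightarrow> complex) \<Rightarrow> complex" where
  "L2_inner M f h = (LINT x|M. f x * cnj (h x))"

definition L2_norm :: "'a measure \<Rightarrow> ('a \<Rightarrow> complex) \<Rightarrow> real" where
  "L2_norm M f = sqrt (LINT x|M. (cmod (f x))\<^sup>2)"

definition L2_bounded_operator ::
    "'a measure \<Rightarrow> (('a \<Rightarrow> complex) \<Rightarrow> ('a \<Rightarrow> complex)) \<Rightarrow> bool" where
  "L2_bounded_operator M B \<longleftrightarrow>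
     (\<forall>f\<in>L2 M. B f \<in> L2 M) \<and>
     (\<forall>f\<in>L2 M. \<forall>g\<in>L2 M. (AE x in M. f x = g x) \<longrightarrow> (AE x in M. B f x = B g x)) \<and>
     (\<forall>f\<in>L2 M. \<forall>g\<in>L2 M. AE x in M. B (\<lambda>y. f y + g y) x = B f x + B g x) \<and>
     (\<forall>c. \<forall>f\<in>L2 M. AE x in M. B (\<lambda>y. c * f y) x = c * B f x) \<and>
     (\<exists>C. \<forall>f\<in>L2 M. L2_norm M (B f) \<le> C * L2_norm M f)"

definition L2_injective ::
    "'a measure \<Rightarrow> (('a \<Rightarrow> complex) \<Rightarrow> ('a \<Rightarrow> complex)) \<Rightarrow> bool" where
  "L2_injective M B \<longleftrightarrow>
     (\<forall>f\<in>L2 M. \<forall>g\<in>L2 M. (AE x in M. B f x = B g x) \<longrightarrow> (AE x in M. f x = g x))"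

definition L2_Bessel_sequence :: "'a measure \<Rightarrow> (nat \<Rightarrow> 'a \<Rightarrow> complex) \<Rightarrow> bool" where
  "L2_Bessel_sequence M F \<longleftrightarrow>
     (\<forall>n. F n \<in> L2 M) \<and>
     (\<exists>C>0. \<forall>f\<in>L2 M.
        summable (\<lambda>n. (cmod (L2_inner M f (F n)))\<^sup>2) \<and>
        (\<Sum>n. (cmod (L2_inner M f (F n)))\<^sup>2) \<le> C * (L2_norm M f)\<^sup>2)"

end

theory Submission
  imports Defs
begin

text \<open>
  Write \<open>e\<^sub>n\<close> for the exponential of frequency \<open>n\<close>. The map \<open>x \<mapsto> 3 * x mod 1\<close> preserves the
  Cantor measure and is mixing for it, so the exponentials of frequency \<open>3 ^ k\<close>
  converge weakly to the constant \<open>c = \<integral> e\<^sub>1\<close>, which is nonzero because the Fourier transform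
  of the measure is a product with no vanishing factor at \<open>1\<close>. Hence their images under a
  bounded operator \<open>B\<close> converge weakly to \<open>c * B 1\<close>. If the \<open>B e\<^sub>n\<close> form a Bessel sequence, then
  they converge weakly to 0, and therefore \<open>B 1 = 0\<close>: the operator is not injective.
\<close>

section \<open>Square-integrable functions\<close>

lemma borel_measurable_cnj [measurable (raw)]:
  "f \<in> borel_measurable M \<Longrightarrow> (\<lambda>x. cnj (f x)) \<in> borel_measurable M"
  by (rule borel_measurable_continuous_on) (auto intro!: continuous_intros)

lemma L2_measurable: "f \<in> L2 M \<Longrightarrow> f \<in> borel_measurable M"
  by (simp add: L2_def)

lemma L2_integrable_square: "f \<in> L2 M \<Longrightarrow> integrable M (\<lambda>x. (cmod (f x))\<^sup>2)"
  by (simp add: L2_def)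

lemma L2_integrable_norm_mult:
  assumes "f \<in> L2 M" "g \<in> L2 M"
  shows "integrable M (\<lambda>x. cmod (f x) * cmod (g x))"
proof (rule Bochner_Integration.integrable_bound)
  show "integrable M (\<lambda>x. (cmod (f x))\<^sup>2 + (cmod (g x))\<^sup>2)"
    using assms by (intro Bochner_Integration.integrable_add L2_integrable_square)
  show "(\<lambda>x. cmod (f x) * cmod (g x)) \<in> borel_measurable M"
    using assms[THEN L2_measurable] by measurable
  have "a * b \<le> a\<^sup>2 + b\<^sup>2" if "0 \<le> a" "0 \<le> b" for a b :: real
    using that sum_squares_bound[of a b] mult_nonneg_nonneg[of a b] by linarith
  then show "AE x in M. norm (cmod (f x) * cmod (g x)) \<le> norm ((cmod (f x))\<^sup>2 + (cmod (g x))\<^sup>2)"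
    by (intro AE_I2) (simp add: abs_mult)
qed

lemma L2_integrable_inner:
  assumes "f \<in> L2 M" "g \<in> L2 M"
  shows "integrable M (\<lambda>x. f x * cnj (g x))"
proof (rule Bochner_Integration.integrable_bound)
  show "integrable M (\<lambda>x. cmod (f x) * cmod (g x))"
    using assms by (rule L2_integrable_norm_mult)
  show "(\<lambda>x. f x * cnj (g x)) \<in> borel_measurable M"
    using assms[THEN L2_measurable] by measurable
qed (simp add: norm_mult)

lemma L2_add:
  assumes "f \<in> L2 M" "g \<in> L2 M"
  shows "(\<lambda>x. f x + g x) \<in> L2 M"
proof -
  have "integrable M (\<lambda>x. (cmod (f x + g x))\<^sup>2)"
  proof (rule Bochner_Integration.integrable_bound)
    show "integrable M (\<lambda>x. (cmod (f x))\<^sup>2 + 2 * (cmod (f x) * cmod (g x)) + (cmod (g x))\<^sup>2)"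
      using assms
      by (intro Bochner_Integration.integrable_add integrable_mult_right
          L2_integrable_square L2_integrable_norm_mult)
    show "(\<lambda>x. (cmod (f x + g x))\<^sup>2) \<in> borel_measurable M"
      using assms[THEN L2_measurable] by measurable
    have "(cmod (a + b))\<^sup>2 \<le> (cmod a)\<^sup>2 + 2 * (cmod a * cmod b) + (cmod b)\<^sup>2" for a b
      using power_mono[OF norm_triangle_ineq[of a b], of 2] by (simp add: power2_sum)
    then show "AE x in M. norm ((cmod (f x + g x))\<^sup>2)
        \<le> norm ((cmod (f x))\<^sup>2 + 2 * (cmod (f x) * cmod (g x)) + (cmod (g x))\<^sup>2)"
      by (intro AE_I2) simp
  qed
  then show ?thesis
    using assms[THEN L2_measurable] by (simp add: L2_def)
qed

lemma L2_cmult: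
  assumes "f \<in> L2 M"
  shows "(\<lambda>x. c * f x) \<in> L2 M"
  using assms by (auto simp: L2_def norm_mult power_mult_distrib)

lemma L2_sum:
  assumes "finite A" "\<And>i. i \<in> A \<Longrightarrow> f i \<in> L2 M"
  shows "(\<lambda>x. \<Sum>i\<in>A. f i x) \<in> L2 M"
  using assms
proof (induction A rule: finite_induct)
  case empty
  show ?case by (simp add: L2_def)
next
  case (insert a A)
  then show ?case using L2_add[of "f a" M "\<lambda>x. \<Sum>i\<in>A. f i x"] by simp
qed

section \<open>Inner product and norm\<close>

lemma L2_norm_nonneg [simp]: "0 \<le> L2_norm M f"
  by (simp add: L2_norm_def)

lemma L2_norm_power2: "(L2_norm M f)\<^sup>2 = (LINT x|M. (cmod (f x))\<^sup>2)"
  by (simp add: L2_norm_def)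

lemma L2_inner_self: "L2_inner M f f = of_real ((L2_norm M f)\<^sup>2)"
  by (simp add: L2_inner_def L2_norm_power2 flip: complex_norm_square integral_complex_of_real)

lemma L2_inner_commute: "L2_inner M g f = cnj (L2_inner M f g)"
  unfolding L2_inner_def by (subst Bochner_Integration.integral_cnj[symmetric]) (simp add: mult.commute)

lemma L2_inner_add_left:
  assumes "f \<in> L2 M" "g \<in> L2 M" "h \<in> L2 M"
  shows "L2_inner M (\<lambda>x. f x + g x) h = L2_inner M f h + L2_inner M g h"
  using assms by (simp add: L2_inner_def distrib_right L2_integrable_inner)

lemma L2_inner_cmult_left: "L2_inner M (\<lambda>x. c * f x) h = c * L2_inner M f h"
  by (simp add: L2_inner_def mult.assoc)

lemma L2_inner_add_right:
  assumes "f \<in> L2 M" "g \<in> L2 M" "h \<in> L2 M"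
  shows "L2_inner M h (\<lambda>x. f x + g x) = L2_inner M h f + L2_inner M h g"
  using assms by (simp add: L2_inner_def distrib_left L2_integrable_inner)

lemma L2_inner_cmult_right: "L2_inner M h (\<lambda>x. c * f x) = cnj c * L2_inner M h f"
  by (simp add: L2_inner_def mult.left_commute)

lemma L2_inner_cong_AE:
  assumes "f \<in> L2 M" "g \<in> L2 M" "h \<in> L2 M" "AE x in M. f x = g x"
  shows "L2_inner M f h = L2_inner M g h"
  unfolding L2_inner_def
  using assms(1-3)[THEN L2_measurable] assms(4) by (intro integral_cong_AE) auto

text \<open>After passing to absolute values, this is Cauchy-Schwarz for nonnegative integrals.
  Square integrability makes all three integrals finite, so the inequality moves from
  \<open>ennreal\<close> to the reals.\<close>

lemma L2_inner_Cauchy_Schwarz: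
  assumes f: "f \<in> L2 M" and g: "g \<in> L2 M"
  shows "cmod (L2_inner M f g) \<le> L2_norm M f * L2_norm M g"
proof -
  note [measurable] = f[THEN L2_measurable] g[THEN L2_measurable]
  let ?I = "LINT x|M. cmod (f x) * cmod (g x)"
  have "cmod (L2_inner M f g) \<le> (LINT x|M. cmod (f x * cnj (g x)))"
    unfolding L2_inner_def by (rule integral_norm_bound)
  then have le: "cmod (L2_inner M f g) \<le> ?I"
    by (simp add: norm_mult)
  have sq: "(\<integral>\<^sup>+ x. (ennreal (cmod (u x)))\<^sup>2 \<partial>M) = ennreal ((L2_norm M u)\<^sup>2)" if "u \<in> L2 M" for u
    unfolding L2_norm_power2
    by (subst nn_integral_eq_integral[symmetric]) (auto simp: ennreal_power L2_integrable_square[OF that])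
  have "(\<integral>\<^sup>+ x. ennreal (cmod (f x)) * ennreal (cmod (g x)) \<partial>M) = ennreal ?I"
    by (subst nn_integral_eq_integral[symmetric])
       (auto simp: ennreal_mult L2_integrable_norm_mult[OF f g])
  then have "(ennreal ?I)\<^sup>2 \<le> ennreal ((L2_norm M f)\<^sup>2) * ennreal ((L2_norm M g)\<^sup>2)"
    using Cauchy_Schwarz_nn_integral[of "\<lambda>x. ennreal (cmod (f x))" M "\<lambda>x. ennreal (cmod (g x))"]
    by (simp add: sq f g)
  then have "?I\<^sup>2 \<le> (L2_norm M f * L2_norm M g)\<^sup>2"
    by (simp add: ennreal_power power_mult_distrib flip: ennreal_mult)
  then have "?I \<le> L2_norm M f * L2_norm M g"
    by (rule power2_le_imp_le) simp
  with le show ?thesis by linarith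
qed

text \<open>The squared norm expands into the sum of all Gram matrix entries; the triangle
  inequality does the rest.\<close>

lemma L2_norm_sum_power2_le:
  assumes A: "finite A" and f: "\<And>i. i \<in> A \<Longrightarrow> f i \<in> L2 M"
  shows "(L2_norm M (\<lambda>x. \<Sum>i\<in>A. f i x))\<^sup>2 \<le> (\<Sum>i\<in>A. \<Sum>j\<in>A. cmod (L2_inner M (f i) (f j)))"
proof -
  have "of_real ((L2_norm M (\<lambda>x. \<Sum>i\<in>A. f i x))\<^sup>2) = (\<Sum>i\<in>A. \<Sum>j\<in>A. L2_inner M (f i) (f j))"
    unfolding L2_inner_self[symmetric] unfolding L2_inner_def
    using f by (simp add: sum_product L2_integrable_inner)
  then have "(L2_norm M (\<lambda>x. \<Sum>i\<in>A. f i x))\<^sup>2 = cmod (\<Sum>i\<in>A. \<Sum>j\<in>A. L2_inner M (f i) (f j))"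
    by (metis abs_of_nonneg norm_of_real zero_le_power2)
  also have "\<dots> \<le> (\<Sum>i\<in>A. \<Sum>j\<in>A. cmod (L2_inner M (f i) (f j)))"
    by (intro order_trans[OF norm_sum] sum_mono) simp
  finally show ?thesis .
qed

text \<open>
  The sum of \<open>N\<close> vectors with widely spaced indices has norm \<open>o(N)\<close>, whereas \<open>l\<close> would map
  it to about \<open>N * L\<close>. This replaces the Riesz representation of \<open>l\<close>.
\<close>
lemma L2_bounded_functional_limit_eq_0:
  fixes v :: "nat \<Rightarrow> 'a \<Rightarrow> complex" and l :: "('a \<Rightarrow> complex) \<Rightarrow> complex"
  assumes add: "\<And>f g. f \<in> L2 M \<Longrightarrow> g \<in> L2 M \<Longrightarrow> l (\<lambda>x. f x + g x) = l f + l g"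
    and bound: "\<And>f. f \<in> L2 M \<Longrightarrow> cmod (l f) \<le> K * L2_norm M f"
    and v: "\<And>k. v k \<in> L2 M" "\<And>k. L2_norm M (v k) \<le> C"
    and orth: "\<And>e. e > 0 \<Longrightarrow> \<exists>m. \<forall>d\<ge>m. \<forall>k. cmod (L2_inner M (v (k + d)) (v k)) \<le> e"
    and lim: "(\<lambda>k. l (v k)) \<longlonglongrightarrow> L"
  shows "L = 0"
proof (rule ccontr)
  assume "L \<noteq> 0"
  have l_sum: "l (\<lambda>x. \<Sum>i<N. f i x) = (\<Sum>i<N. l (f i))" if "\<And>i. f i \<in> L2 M" for f and N :: nat
  proof (induction N)
    case 0
    show ?case using add[of "\<lambda>_. 0" "\<lambda>_. 0"] by (simp add: L2_def)
  next
    case (Suc N)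
    then show ?case using add[OF L2_sum[of "{..<N}" f] that[of N]] that by simp
  qed
  have key: "(cmod L / 2)\<^sup>2 \<le> K\<^sup>2 * e" if "e > 0" for e
  proof -
    obtain m' where m': "cmod (L2_inner M (v (k + d)) (v k)) \<le> e" if "d \<ge> m'" for d k
      using orth[OF \<open>e > 0\<close>] by blast
    define m where "m = Suc m'"
    \<comment> \<open>Past \<open>n0\<close> each value of \<open>l\<close> is within half of
      \<open>cmod L\<close> from \<open>L\<close>, so a sum of \<open>N\<close> such values has
      modulus at least \<open>N * cmod L / 2\<close>.\<close>
    obtain n0 where n0: "cmod (l (v k) - L) \<le> cmod L / 2" if "k \<ge> n0" for k
      using LIMSEQ_D[OF lim, of "cmod L / 2"] \<open>L \<noteq> 0\<close> by (auto intro: less_imp_le)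
    \<comment> \<open>The selected indices lie \<open>m\<close> apart, so distinct
      \<open>w i\<close> and \<open>w j\<close> satisfy the bound supplied by
      \<open>m'\<close>.\<close>
    define w where "w i = v (n0 + i * m)" for i
    have w: "w i \<in> L2 M" for i by (simp add: w_def v)
    have w_less: "cmod (L2_inner M (w j) (w i)) \<le> e" if "i < j" for i j
    proof -
      have "i * m + m \<le> j * m"
        using mult_le_mono1[of "Suc i" j m] that by simp
      then obtain d where "j * m = i * m + d" "d \<ge> m'"
        by (intro that[of "j * m - i * m"]) (auto simp: m_def)
      then show ?thesis using m'[of d "n0 + i * m"] by (simp add: w_def add.assoc)
    qed
    have w_ne: "cmod (L2_inner M (w i) (w j)) \<le> e" if "i \<noteq> j" for i j
      using that w_less[of i j] w_less[of j i] L2_inner_commute[of M "w i" "w j"]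
      by (cases "i < j") auto
    have w_eq: "cmod (L2_inner M (w i) (w i)) \<le> C\<^sup>2" for i
      by (simp add: L2_inner_self w_def norm_power power_mono v)
    have step: "(cmod L / 2)\<^sup>2 \<le> K\<^sup>2 * (C\<^sup>2 / N + e)" if "N > 0" for N :: nat
    proof -
      define f where "f x = (\<Sum>i<N. w i x)" for x
      have f: "f \<in> L2 M" unfolding f_def by (intro L2_sum w) simp
      have "(L2_norm M f)\<^sup>2 \<le> (\<Sum>i<N. \<Sum>j<N. cmod (L2_inner M (w i) (w j)))"
        unfolding f_def by (intro L2_norm_sum_power2_le w) simp
      \<comment> \<open>The \<open>N\<close> diagonal entries contribute at most
        \<open>C\<^sup>2\<close> each. Allowing \<open>e\<close> on the diagonal as well keeps the
        double sum easy to evaluate.\<close>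
      also have "\<dots> \<le> (\<Sum>i<N. \<Sum>j<N. (if i = j then C\<^sup>2 else 0) + e)"
        using w_ne w_eq \<open>e > 0\<close> by (intro sum_mono) (auto intro: add_increasing2)
      also have "\<dots> = N * C\<^sup>2 + N * N * e"
        by (simp add: sum.distrib algebra_simps)
      finally have norm_f: "(L2_norm M f)\<^sup>2 \<le> N * C\<^sup>2 + N * N * e" .
      have "l f = (\<Sum>i<N. l (w i))" unfolding f_def by (intro l_sum w)
      then have "cmod (N * L - l f) = cmod (\<Sum>i<N. l (w i) - L)"
        by (simp add: sum_subtractf norm_minus_commute)
      also have "\<dots> \<le> (\<Sum>i<N. cmod L / 2)"
        using n0 by (intro order_trans[OF norm_sum] sum_mono) (simp add: w_def del: le_divide_eq_numeral1)
      finally have "N * cmod L \<le> cmod (l f) + N * (cmod L / 2)"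
        using norm_triangle_sub[of "N * L" "l f"] by (simp add: norm_mult)
      then have "N * (cmod L / 2) \<le> K * L2_norm M f"
        using bound[OF f] by simp
      then have "(N * (cmod L / 2))\<^sup>2 \<le> (K * L2_norm M f)\<^sup>2"
        by (intro power_mono) auto
      also have "\<dots> \<le> K\<^sup>2 * (N * C\<^sup>2 + N * N * e)"
        using norm_f by (simp add: power_mult_distrib mult_left_mono)
      also have "\<dots> = (real N)\<^sup>2 * (K\<^sup>2 * (C\<^sup>2 / N + e))"
        using \<open>N > 0\<close> by (simp add: field_simps power2_eq_square)
      finally have "(real N)\<^sup>2 * (cmod L / 2)\<^sup>2 \<le> (real N)\<^sup>2 * (K\<^sup>2 * (C\<^sup>2 / N + e))"
        by (simp only: power_mult_distrib)
      then show ?thesis using \<open>N > 0\<close> by (simp add: mult_le_cancel_left_pos)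
    qed
    \<comment> \<open>Letting \<open>N\<close> grow removes the diagonal contribution; only
      afterwards does \<open>e\<close> tend to 0, because the selection of the \<open>w i\<close>
      depends on \<open>e\<close>.\<close>
    have "(\<lambda>N. K\<^sup>2 * (C\<^sup>2 / real N + e)) \<longlonglongrightarrow> K\<^sup>2 * (0 + e)"
      by (intro tendsto_intros lim_const_over_n)
    then show ?thesis
      using step by (intro Lim_bounded2[where N = 1]) auto
  qed
  have "((\<lambda>e. K\<^sup>2 * e) \<longlongrightarrow> K\<^sup>2 * 0) (at_right 0)"
    by (intro tendsto_intros)
  then have "(cmod L / 2)\<^sup>2 \<le> K\<^sup>2 * 0"
    by (rule tendsto_lowerbound) (auto simp: eventually_at_filter key)
  with \<open>L \<noteq> 0\<close> show False by simp
qed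

section \<open>Self-similarity of the Cantor law\<close>

abbreviation digit_pmf :: "real pmf" where
  "digit_pmf \<equiv> pmf_of_set {0, 1}"

interpretation digits: sequence_space "measure_pmf digit_pmf"
  by unfold_locales

definition digit_sum :: "(nat \<Rightarrow> real) \<Rightarrow> real" where
  "digit_sum \<epsilon> = (\<Sum>k. 2 * \<epsilon> k / 3 ^ Suc k)"

lemma digit_measurable: "(\<lambda>x. x) \<in> borel_measurable (measure_pmf digit_pmf)"
  by simp

lemma digit_sum_measurable [measurable]: "digit_sum \<in> borel_measurable digits.S"
proof -
  have "(\<lambda>\<epsilon>. \<epsilon> k) \<in> borel_measurable digits.S" for k
    using measurable_compose[OF measurable_component_singleton[of k UNIV "\<lambda>_. measure_pmf digit_pmf"],
        of id borel] by simp
  then show ?thesis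
    unfolding digit_sum_def by (intro borel_measurable_suminf borel_measurable_divide borel_measurable_times) auto
qed

lemma cantor_law_eq: "cantor_law = distr digits.S borel digit_sum"
  by (simp add: cantor_law_def digit_sum_def[abs_def])

lemma sets_cantor_law [measurable_cong, simp]: "sets cantor_law = sets borel"
  and space_cantor_law [simp]: "space cantor_law = UNIV"
  by (simp_all add: cantor_law_def)

interpretation cantor: real_distribution cantor_law
proof -
  have "prob_space cantor_law"
    unfolding cantor_law_eq by (intro digits.prob_space_distr) measurable
  then show "real_distribution cantor_law"
    by (intro real_distribution.intro real_distribution_axioms.intro) auto
qed

section \<open>Digit expansions\<close>

lemma AE_digits: "AE \<epsilon> in digits.S. \<forall>k. \<epsilon> k \<in> {0, 1}"
proof -
  have "AE \<epsilon> in digits.S. \<epsilon> k \<in> {0, 1}" for k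
    by (rule AE_PiM_component) (auto simp: AE_measure_pmf_iff measure_pmf.prob_space_axioms)
  then show ?thesis by (simp add: AE_all_countable)
qed

lemma summable_digits:
  assumes "\<forall>k. \<epsilon> k \<in> {0, 1}"
  shows "summable (\<lambda>k. 2 * \<epsilon> k / 3 ^ Suc k :: real)"
proof (rule summable_comparison_test)
  show "summable (\<lambda>k. (2/3) * (1/3) ^ k :: real)"
    by (intro summable_mult summable_geometric) simp
  have "norm (2 * \<epsilon> k / 3 ^ Suc k) \<le> (2/3) * (1/3) ^ k" for k
    using assms[rule_format, of k] by (auto simp: power_one_over field_simps)
  then show "\<exists>N. \<forall>k\<ge>N. norm (2 * \<epsilon> k / 3 ^ Suc k) \<le> (2/3) * (1/3) ^ k"
    by blast
qed

lemma digit_sum_bounds: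
  assumes "\<forall>k. \<epsilon> k \<in> {0, 1}"
  shows "digit_sum \<epsilon> \<in> {0..1}"
proof -
  have "(\<lambda>k. (2/3) * (1/3) ^ k :: real) sums ((2/3) * (1 / (1 - 1/3)))"
    by (intro sums_mult geometric_sums) simp
  then have s: "(\<lambda>k. (2/3) * (1/3) ^ k :: real) sums 1" by simp
  have "2 * \<epsilon> k / 3 ^ Suc k \<le> (2/3) * (1/3) ^ k" for k
    using assms[rule_format, of k] by (auto simp: power_one_over field_simps)
  then have "digit_sum \<epsilon> \<le> 1"
    unfolding digit_sum_def
    using suminf_le[OF _ summable_digits[OF assms] sums_summable[OF s]] sums_unique[OF s] by simp
  moreover have "0 \<le> 2 * \<epsilon> k / 3 ^ Suc k" for k
    using assms[rule_format, of k] by auto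
  then have "0 \<le> digit_sum \<epsilon>"
    unfolding digit_sum_def by (intro suminf_nonneg summable_digits assms)
  ultimately show ?thesis by simp
qed

text \<open>Prepending a digit moves every other digit one place down, which divides its weight by
  3.\<close>

lemma digit_sum_case_nat:
  assumes "\<forall>k. \<epsilon> k \<in> {0, 1}"
  shows "digit_sum (case_nat a \<epsilon>) = (2 * a + digit_sum \<epsilon>) / 3"
proof -
  have s: "(\<lambda>k. 2 * \<epsilon> k / 3 ^ Suc k) sums digit_sum \<epsilon>"
    unfolding digit_sum_def by (rule summable_sums[OF summable_digits[OF assms]])
  have "(\<lambda>k. 2 * case_nat a \<epsilon> (Suc k) / 3 ^ Suc (Suc k)) sums (digit_sum \<epsilon> / 3)"
    using sums_divide[OF s, of 3] by (simp add: field_simps)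
  then have "(\<lambda>k. 2 * case_nat a \<epsilon> k / 3 ^ Suc k) sums (digit_sum \<epsilon> / 3 + 2 * a / 3)"
    by (subst (asm) sums_Suc_iff) simp
  then show ?thesis
    unfolding digit_sum_def[of "case_nat a \<epsilon>"] by (simp add: sums_unique[symmetric] add_divide_distrib)
qed

lemma AE_cantor_law: "AE x in cantor_law. x \<in> {0..1}"
  unfolding cantor_law_eq
  using AE_digits
  by (subst AE_distr_iff) (auto elim!: eventually_mono dest!: digit_sum_bounds simp del: insert_iff atLeastAtMost_iff)

text \<open>A sequence of independent digits is a first digit followed by an independent copy of the
  sequence. Hence the law is the average of its images under the two contractions that generate the
  Cantor set.\<close>

lemma nn_integral_cantor_law:
  assumes [measurable]: "f \<in> borel_measurable borel"
  shows "(\<integral>\<^sup>+ x. f x \<partial>cantor_law)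
    = ((\<integral>\<^sup>+ x. f (x / 3) \<partial>cantor_law) + (\<integral>\<^sup>+ x. f ((2 + x) / 3) \<partial>cantor_law)) / 2"
proof -
  have "(\<integral>\<^sup>+ x. f x \<partial>cantor_law) = (\<integral>\<^sup>+ \<epsilon>. f (digit_sum \<epsilon>) \<partial>digits.S)"
    by (simp add: cantor_law_eq nn_integral_distr)
  also have "\<dots> = (\<integral>\<^sup>+ z. f (digit_sum (case z of (a, \<epsilon>) \<Rightarrow> case_nat a \<epsilon>)) \<partial>(measure_pmf digit_pmf \<Otimes>\<^sub>M digits.S))"
    by (subst digits.PiM_iter[symmetric]) (subst nn_integral_distr, simp_all)
  also have "\<dots> = (\<integral>\<^sup>+ a. \<integral>\<^sup>+ \<epsilon>. f (digit_sum (case_nat a \<epsilon>)) \<partial>digits.S \<partial>measure_pmf digit_pmf)"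
    by (subst digits.nn_integral_fst[symmetric]) simp_all
  also have "\<dots> = (\<integral>\<^sup>+ a. \<integral>\<^sup>+ \<epsilon>. f ((2 * a + digit_sum \<epsilon>) / 3) \<partial>digits.S \<partial>measure_pmf digit_pmf)"
    using AE_digits
    by (intro nn_integral_cong nn_integral_cong_AE) (auto elim!: eventually_mono simp: digit_sum_case_nat)
  also have "\<dots> = (\<integral>\<^sup>+ a. \<integral>\<^sup>+ x. f ((2 * a + x) / 3) \<partial>cantor_law \<partial>measure_pmf digit_pmf)"
    by (simp add: cantor_law_eq nn_integral_distr)
  also have "\<dots> = ((\<integral>\<^sup>+ x. f (x / 3) \<partial>cantor_law) + (\<integral>\<^sup>+ x. f ((2 + x) / 3) \<partial>cantor_law)) / 2"
    by (subst nn_integral_pmf_of_set) simp_all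
  finally show ?thesis .
qed

text \<open>Of the two contractions, \<open>x / 3\<close> almost surely misses 1, and
  \<open>(2 + x) / 3\<close> takes the value 1 only at 1. The mass of this point therefore equals
  half of itself.\<close>

lemma measure_cantor_law_1: "measure cantor_law {1} = 0"
proof -
  let ?p = "emeasure cantor_law {1}"
  have [measurable]: "{1} \<in> sets cantor_law" by simp
  have "AE x in cantor_law. indicator {1} (x / 3) = (0::ennreal)"
    using AE_cantor_law by eventually_elim (auto split: split_indicator)
  then have 0: "(\<integral>\<^sup>+ x. indicator {1} (x / 3) \<partial>cantor_law) = 0"
    by (subst nn_integral_cong_AE[where v = "\<lambda>_. 0"]) auto
  have "indicator {1} ((2 + x) / 3) = (indicator {1} x :: ennreal)" for x :: real
    by (auto split: split_indicator)
  then have "?p = ?p / 2"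
    using nn_integral_cantor_law[of "indicator {1}"] 0 by simp
  \<comment> \<open>Finiteness matters here: in \<open>ennreal\<close> the equation
    \<open>?p = ?p / 2\<close> also holds for infinity.\<close>
  then have "ennreal (measure cantor_law {1}) = ennreal (measure cantor_law {1} / 2)"
    by (simp add: cantor.emeasure_eq_measure ennreal_divide_numeral)
  then show ?thesis
    by (subst (asm) ennreal_inj) auto
qed

lemma AE_cantor_law_Ico: "AE x in cantor_law. x \<in> {0..<1}"
proof -
  have "AE x in cantor_law. x \<notin> {1}"
    by (rule AE_not_in) (simp add: null_sets_def cantor.emeasure_eq_measure measure_cantor_law_1)
  with AE_cantor_law show ?thesis by eventually_elim auto
qed

text \<open>Self-similarity as an equality of measures, so that it also applies to the complex
  integrand of \<open>char\<close>.\<close>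

lemma cantor_law_self_similar:
  "cantor_law = distr (measure_pmf digit_pmf \<Otimes>\<^sub>M cantor_law) borel (\<lambda>(a, x). (2 * a + x) / 3)"
    (is "_ = distr ?P _ ?g")
proof (rule measure_eqI)
  have [measurable]: "?g \<in> borel_measurable ?P"
    using digit_measurable by measurable
  fix A assume "A \<in> sets cantor_law"
  then have [measurable]: "A \<in> sets borel" by simp
  have "emeasure (distr ?P borel ?g) A = (\<integral>\<^sup>+ z. indicator A (?g z) \<partial>?P)"
    by (subst nn_integral_indicator[symmetric], simp, subst nn_integral_distr) simp_all
  also have "\<dots> = (\<integral>\<^sup>+ a. \<integral>\<^sup>+ x. indicator A ((2 * a + x) / 3) \<partial>cantor_law \<partial>measure_pmf digit_pmf)"
    by (subst cantor.nn_integral_fst[symmetric]) simp_all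
  also have "\<dots> = (\<integral>\<^sup>+ x. indicator A x \<partial>cantor_law)"
    using nn_integral_cantor_law[of "indicator A"] by (subst nn_integral_pmf_of_set) simp_all
  finally show "emeasure cantor_law A = emeasure (distr ?P borel ?g) A"
    by simp
qed simp

text \<open>Under the self-similar representation the exponential splits into a digit factor and a
  factor in \<open>x\<close>. Averaging the former over the digits 0 and 1 gives
  \<open>(1 + cis (2 * t / 3)) / 2\<close>.\<close>

lemma char_cantor_law: "char cantor_law t = (1 + cis (2 * t / 3)) / 2 * char cantor_law (t / 3)"
proof -
  let ?P = "measure_pmf digit_pmf \<Otimes>\<^sub>M cantor_law"
  interpret P: pair_prob_space "measure_pmf digit_pmf" cantor_law ..
  have [measurable]: "(\<lambda>(a, x). (2 * a + x) / 3) \<in> borel_measurable ?P"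
    using digit_measurable by measurable
  have int: "integrable ?P (\<lambda>z. iexp (t * (case z of (a, x) \<Rightarrow> (2 * a + x) / 3)))"
    by (rule P.P.integrable_iexp) auto
  have "char cantor_law t = (CLINT z|?P. iexp (t * (case z of (a, x) \<Rightarrow> (2 * a + x) / 3)))"
    unfolding char_def by (subst cantor_law_self_similar) (subst integral_distr, simp_all)
  also have "\<dots> = (CLINT a|measure_pmf digit_pmf. CLINT x|cantor_law. iexp (t * ((2 * a + x) / 3)))"
    by (subst P.integral_fst'[symmetric, OF int]) simp
  also have "\<dots> = (CLINT a|measure_pmf digit_pmf. iexp (2 * t * a / 3) * char cantor_law (t / 3))"
    by (simp add: char_def distrib_left add_divide_distrib exp_add mult_ac flip: integral_mult_right_zero)
  also have "\<dots> = (1 + cis (2 * t / 3)) / 2 * char cantor_law (t / 3)"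
    unfolding cis_conv_exp by (subst integral_measure_pmf[of "{0, 1}"]) (auto simp: scaleR_conv_of_real field_simps)
  finally show ?thesis .
qed

section \<open>Fourier coefficients of the Cantor law\<close>

text \<open>The scaling makes the value at an integer the integral of the exponential of that
  frequency. Real arguments are allowed because the recursion divides by 3.\<close>

definition cantor_fourier :: "real \<Rightarrow> complex" where
  "cantor_fourier t = char cantor_law (2 * pi * t)"

lemma cantor_fourier_0 [simp]: "cantor_fourier 0 = 1"
  by (simp add: cantor_fourier_def cantor.char_zero)

lemma cantor_fourier_minus: "cantor_fourier (- t) = cnj (cantor_fourier t)"
  unfolding cantor_fourier_def char_def
  by (subst Bochner_Integration.integral_cnj[symmetric]) (simp add: exp_cnj)

lemma isCont_cantor_fourier: "isCont cantor_fourier t"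
  unfolding cantor_fourier_def [abs_def]
  by (intro isCont_o2[OF _ cantor.isCont_char] continuous_intros)

lemma cantor_fourier_rec:
  "cantor_fourier t = (1 + cis (4 * pi * t / 3)) / 2 * cantor_fourier (t / 3)"
  using char_cantor_law[of "2 * pi * t"] by (simp add: cantor_fourier_def mult.assoc)

lemma cis_add_4pi:
  assumes "n \<in> \<int>"
  shows "cis (4 * pi * n + x) = cis x"
  using cis_multiple_2pi[of "2 * n"] assms by (simp add: mult.assoc flip: cis_mult)

text \<open>The factor split off by the recursion is 1 at \<open>3 * n\<close>. This is the
  invariance of the measure under multiplication by 3 modulo 1, read on Fourier
  coefficients.\<close>

lemma cantor_fourier_times_3:
  assumes "n \<in> \<int>"
  shows "cantor_fourier (3 * n) = cantor_fourier n"
  using cantor_fourier_rec[of "3 * n"] cis_add_4pi[OF assms, of 0] by (simp add: mult.assoc)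

lemma cantor_fourier_times_power_3:
  assumes "n \<in> \<int>"
  shows "cantor_fourier (3 ^ k * n) = cantor_fourier n"
proof (induction k)
  case (Suc k)
  then show ?case
    using cantor_fourier_times_3[of "3 ^ k * n"] assms by (simp add: mult.assoc)
qed simp

text \<open>
  Both sides equal \<open>p(t) h(q + t / 3 ^ m) h(t / 3 ^ m)\<close>, where \<open>h\<close> is the Fourier
  transform and \<open>p\<close> is the product of its first \<open>m\<close> factors, which does not change when
  \<open>3 ^ m * q\<close> is added to \<open>t\<close>.
\<close>
lemma cantor_fourier_shift:
  assumes "q \<in> \<int>"
  shows "cantor_fourier (3 ^ m * q + t) * cantor_fourier (t / 3 ^ m)
    = cantor_fourier t * cantor_fourier (q + t / 3 ^ m)"
proof (induction m arbitrary: t)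
  case 0
  show ?case by simp
next
  case (Suc m)
  have "4 * pi * (3 ^ Suc m * q + t) / 3 = 4 * pi * (3 ^ m * q) + 4 * pi * t / 3"
    by (simp add: field_simps)
  moreover have "(3 ^ Suc m * q + t) / 3 = 3 ^ m * q + t / 3"
    by (simp add: field_simps)
  moreover have "3 ^ m * q \<in> \<int>" using assms by simp
  ultimately have "cantor_fourier (3 ^ Suc m * q + t)
      = (1 + cis (4 * pi * t / 3)) / 2 * cantor_fourier (3 ^ m * q + t / 3)"
    using cantor_fourier_rec[of "3 ^ Suc m * q + t"] cis_add_4pi by (simp only:)
  then have "cantor_fourier (3 ^ Suc m * q + t) * cantor_fourier (t / 3 ^ Suc m)
      = (1 + cis (4 * pi * t / 3)) / 2
        * (cantor_fourier (3 ^ m * q + t / 3) * cantor_fourier (t / 3 / 3 ^ m))"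
    by simp
  also have "\<dots> = ((1 + cis (4 * pi * t / 3)) / 2 * cantor_fourier (t / 3))
      * cantor_fourier (q + t / 3 / 3 ^ m)"
    by (simp only: Suc mult.assoc)
  also have "\<dots> = cantor_fourier t * cantor_fourier (q + t / 3 ^ Suc m)"
    by (simp only: cantor_fourier_rec[of t, symmetric]) simp
  finally show ?case .
qed

text \<open>This is the mixing property in the only form required. The shift identity with
  \<open>q = 1\<close> and \<open>t = - 1\<close> expresses the coefficient through values near
  \<open>1\<close>, at \<open>- 1\<close> and near \<open>0\<close>, and continuity gives the
  limit.\<close>

lemma cantor_fourier_decorrelation:
  "(\<lambda>m. cantor_fourier (3 ^ m - 1)) \<longlonglongrightarrow> of_real ((cmod (cantor_fourier 1))\<^sup>2)"
proof -
  have z: "(\<lambda>m. (- 1 :: real) / 3 ^ m) \<longlonglongrightarrow> 0"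
    by (rule LIMSEQ_divide_realpow_zero) simp
  have lim0: "(\<lambda>m. cantor_fourier (- 1 / 3 ^ m)) \<longlonglongrightarrow> 1"
    using isCont_tendsto_compose[OF isCont_cantor_fourier z] by simp
  have "(\<lambda>m. 1 + (- 1 :: real) / 3 ^ m) \<longlonglongrightarrow> 1 + 0"
    by (intro tendsto_add tendsto_const z)
  then have lim1: "(\<lambda>m. cantor_fourier (1 + - 1 / 3 ^ m)) \<longlonglongrightarrow> cantor_fourier 1"
    by (intro isCont_tendsto_compose[OF isCont_cantor_fourier]) simp
  \<comment> \<open>The shift identity may be divided by this value once \<open>m\<close> is large,
    since it tends to 1.\<close>
  have "eventually (\<lambda>m. cantor_fourier (- 1 / 3 ^ m) \<noteq> 0) sequentially"
    using lim0 by (rule tendsto_imp_eventually_ne) simp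
  then have "eventually (\<lambda>m. cantor_fourier (- 1) * cantor_fourier (1 + - 1 / 3 ^ m)
      / cantor_fourier (- 1 / 3 ^ m) = cantor_fourier (3 ^ m - 1)) sequentially"
  proof eventually_elim
    case (elim m)
    then show ?case using cantor_fourier_shift[of 1 m "- 1"] by (simp add: field_simps)
  qed
  moreover have "(\<lambda>m. cantor_fourier (- 1) * cantor_fourier (1 + - 1 / 3 ^ m)
      / cantor_fourier (- 1 / 3 ^ m)) \<longlonglongrightarrow> cantor_fourier (- 1) * cantor_fourier 1 / 1"
    by (intro tendsto_intros lim0 lim1) simp
  moreover have "cantor_fourier (- 1) * cantor_fourier 1 / 1 = of_real ((cmod (cantor_fourier 1))\<^sup>2)"
    by (simp add: cantor_fourier_minus complex_norm_square mult.commute del: of_real_power)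
  ultimately show ?thesis by (simp add: tendsto_cong)
qed

lemma cantor_fourier_1_nonzero: "cantor_fourier 1 \<noteq> 0"
proof -
  \<comment> \<open>After two steps of the recursion the frequency is so small that the integrand has positive
    real part on \<open>[0, 1]\<close>.\<close>
  have int: "integrable cantor_law (\<lambda>x. iexp (2 * pi * (1 / 9) * x))"
    by (rule cantor.integrable_iexp) auto
  have "Re (cantor_fourier (1 / 9)) = (LINT x|cantor_law. cos (2 * pi * x / 9))"
    unfolding cantor_fourier_def char_def
    by (subst integral_Re[symmetric]) (use int in \<open>auto simp: Re_exp\<close>)
  also have "\<dots> \<ge> cos (2 * pi / 9)"
  proof (rule cantor.integral_ge_const)
    show "integrable cantor_law (\<lambda>x. cos (2 * pi * x / 9))"
      using integrable_Re[OF int] by (simp add: Re_exp)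
    show "AE x in cantor_law. cos (2 * pi / 9) \<le> cos (2 * pi * x / 9)"
      using AE_cantor_law by eventually_elim (intro cos_monotone_0_pi_le; simp)
  qed
  moreover have "0 < cos (2 * pi / 9)"
    by (rule cos_gt_zero_pi) (use pi_gt_zero in linarith)+
  ultimately have ninth: "cantor_fourier (1 / 9) \<noteq> 0" by auto
  \<comment> \<open>A factor of the recursion vanishes only where the cosine is -1. The two angles
    that occur are \<open>4 * pi / 9\<close>, strictly below \<open>pi\<close>, and
    \<open>4 * pi / 3\<close>, with cosine -1/2.\<close>
  have factor: "(1 + cis x) / 2 \<noteq> 0" if "cos x \<noteq> - 1" for x
    using that by (auto simp: add_eq_0_iff dest!: arg_cong[of _ _ Re])
  have "cos (4 * pi * (1 / 3) / 3) \<noteq> - 1"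
    using cos_monotone_0_pi[of "4 * pi * (1 / 3) / 3" pi] by simp
  note factor1 = factor[OF this]
  have "4 * pi * 1 / 3 = pi / 3 + pi" by simp
  then have "cos (4 * pi * 1 / 3) \<noteq> - 1"
    by (simp only: cos_periodic_pi cos_60)
  note factor2 = factor[OF this]
  have "cantor_fourier (1 / 3) \<noteq> 0"
    using factor1 ninth by (subst cantor_fourier_rec) (simp only: mult_eq_0_iff, simp)
  then show ?thesis
    using factor2 by (subst cantor_fourier_rec) (simp only: mult_eq_0_iff, simp)
qed

section \<open>Exponentials under the Cantor measure\<close>

interpretation cantor_measure: prob_space cantor_measure
proof -
  have "emeasure cantor_law {0..<1} = 1"
    using cantor.emeasure_eq_1_AE[of "{0..<1}"] AE_cantor_law_Ico by simp
  then show "prob_space cantor_measure"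
    unfolding cantor_measure_def by (intro prob_space_restrict_space) auto
qed

text \<open>Transfers the Fourier formulas, obtained for the law on the whole line, to its
  restriction to \<open>{0..<1}\<close>.\<close>

lemma integral_cantor_measure:
  fixes f :: "real \<Rightarrow> complex"
  assumes [measurable]: "f \<in> borel_measurable borel"
  shows "(LINT x|cantor_measure. f x) = (LINT x|cantor_law. f x)"
proof -
  have "(LINT x|cantor_measure. f x) = (LINT x|cantor_law. indicator {0..<1} x *\<^sub>R f x)"
    unfolding cantor_measure_def by (rule integral_restrict_space) simp
  also have "\<dots> = (LINT x|cantor_law. f x)"
  proof (rule integral_cong_AE)
    show "AE x in cantor_law. indicator {0..<1} x *\<^sub>R f x = f x"
      using AE_cantor_law_Ico by eventually_elim simp
  qed simp_all
  finally show ?thesis .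
qed

definition exponential :: "nat \<Rightarrow> real \<Rightarrow> complex" where
  "exponential n = (\<lambda>x. cis (2 * pi * n * x))"

lemma exponential_0: "exponential 0 = (\<lambda>_. 1)"
  by (simp add: exponential_def)

lemma exponential_L2: "exponential n \<in> L2 cantor_measure"
proof -
  have "exponential n \<in> borel_measurable cantor_measure"
    unfolding cantor_measure_def exponential_def cis_conv_exp
    by (intro measurable_restrict_space1) measurable
  then show ?thesis
    by (simp add: L2_def) (simp add: exponential_def)
qed

text \<open>The product of one exponential with the conjugate of another is the exponential of the
  frequency difference, which may be negative.\<close>

lemma exponential_inner:
  "L2_inner cantor_measure (exponential m) (exponential n) = cantor_fourier (real m - real n)"
proof -
  have "exponential m x * cnj (exponential n x) = iexp (2 * pi * (real m - real n) * x)" for x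
    unfolding cis_conv_exp[symmetric] by (simp add: exponential_def cis_cnj cis_mult algebra_simps)
  then show ?thesis
    unfolding L2_inner_def cantor_fourier_def char_def
    by (subst integral_cantor_measure) simp_all
qed

text \<open>The exponential of frequency \<open>3 ^ k\<close> minus its mean, which by invariance is
  the same for all \<open>k\<close>. The constant is kept as a multiple of
  \<open>exponential 0\<close> so that the operator can be applied term by term.\<close>

definition lacunary :: "nat \<Rightarrow> real \<Rightarrow> complex" where
  "lacunary k = (\<lambda>x. exponential (3 ^ k) x + (- cantor_fourier 1) * exponential 0 x)"

lemma lacunary_L2: "lacunary k \<in> L2 cantor_measure"
  unfolding lacunary_def by (intro L2_add L2_cmult exponential_L2)

text \<open>Centring subtracts the product of the means. The common factor \<open>3 ^ k\<close> of
  the frequency difference drops out by invariance, so the result depends on \<open>d\<close>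
  alone.\<close>

lemma lacunary_inner:
  "L2_inner cantor_measure (lacunary (k + d)) (lacunary k)
    = cantor_fourier (3 ^ d - 1) - of_real ((cmod (cantor_fourier 1))\<^sup>2)"
proof -
  let ?c = "cantor_fourier 1"
  have mean: "cantor_fourier (3 ^ j) = ?c" for j
    using cantor_fourier_times_power_3[of 1 j] by simp
  have "L2_inner cantor_measure (lacunary (k + d)) (lacunary k)
      = cantor_fourier (3 ^ (k + d) - 3 ^ k) - ?c * cnj (cantor_fourier (3 ^ k))
        - cnj ?c * cantor_fourier (3 ^ (k + d)) + ?c * cnj ?c"
    unfolding lacunary_def
    by (simp only: L2_inner_add_left L2_inner_add_right L2_inner_cmult_left L2_inner_cmult_right
        exponential_inner L2_add L2_cmult exponential_L2)
       (simp add: algebra_simps flip: cantor_fourier_minus)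
  also have "\<dots> = cantor_fourier (3 ^ k * (3 ^ d - 1)) - ?c * cnj ?c"
    by (simp only: mean) (simp add: algebra_simps power_add)
  also have "cantor_fourier (3 ^ k * (3 ^ d - 1)) = cantor_fourier (3 ^ d - 1)"
    by (rule cantor_fourier_times_power_3) simp
  finally show ?thesis
    by (simp add: complex_norm_square del: of_real_power)
qed

lemma lacunary_norm_le: "L2_norm cantor_measure (lacunary k) \<le> 1"
proof -
  have "complex_of_real ((L2_norm cantor_measure (lacunary k))\<^sup>2)
      = of_real (1 - (cmod (cantor_fourier 1))\<^sup>2)"
    using lacunary_inner[of k 0] by (simp add: L2_inner_self)
  then have "(L2_norm cantor_measure (lacunary k))\<^sup>2 = 1 - (cmod (cantor_fourier 1))\<^sup>2"
    by (simp only: of_real_eq_iff)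
  then show ?thesis
    by (simp add: power2_le_imp_le)
qed

lemma lacunary_almost_orthogonal:
  assumes "e > 0"
  shows "\<exists>m. \<forall>d\<ge>m. \<forall>k. cmod (L2_inner cantor_measure (lacunary (k + d)) (lacunary k)) \<le> e"
proof -
  obtain m where "\<forall>d\<ge>m. cmod (cantor_fourier (3 ^ d - 1) - of_real ((cmod (cantor_fourier 1))\<^sup>2)) < e"
    using LIMSEQ_D[OF cantor_fourier_decorrelation assms] by (rule exE)
  then show ?thesis
    unfolding lacunary_inner by (auto intro!: exI[of _ m] intro: less_imp_le)
qed

section \<open>Bounded operators and the Bessel condition\<close>

lemma L2_bounded_operator_exponential_0_eq_0:
  assumes B: "L2_bounded_operator cantor_measure B"
    and lim: "(\<lambda>n. L2_inner cantor_measure (B (exponential n)) (B (exponential 0))) \<longlonglongrightarrow> 0"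
  shows "AE x in cantor_measure. B (exponential 0) x = 0"
proof -
  let ?M = cantor_measure
  \<comment> \<open>Testing against the image of the constant 1 makes
    \<open>l (exponential 0)\<close> equal to the squared norm of that image.\<close>
  define l where "l f = L2_inner ?M (B f) (B (exponential 0))" for f
  have BL2: "B f \<in> L2 ?M" if "f \<in> L2 ?M" for f
    using B that by (simp add: L2_bounded_operator_def)
  note B0 = BL2[OF exponential_L2[of 0]]
  obtain C where C: "L2_norm ?M (B f) \<le> C * L2_norm ?M f" if "f \<in> L2 ?M" for f
    using B unfolding L2_bounded_operator_def by (elim conjE exE) (rule that, erule bspec)
  have add: "l (\<lambda>x. f x + g x) = l f + l g" if fg: "f \<in> L2 ?M" "g \<in> L2 ?M" for f g
  proof -
    have "AE x in ?M. B (\<lambda>y. f y + g y) x = B f x + B g x"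
      using B fg by (simp add: L2_bounded_operator_def)
    then have "l (\<lambda>x. f x + g x) = L2_inner ?M (\<lambda>x. B f x + B g x) (B (exponential 0))"
      unfolding l_def by (intro L2_inner_cong_AE BL2 L2_add fg exponential_L2)
    then show ?thesis
      by (simp add: l_def L2_inner_add_left BL2 fg B0)
  qed
  have cmult: "l (\<lambda>x. c * f x) = c * l f" if f: "f \<in> L2 ?M" for c f
  proof -
    have "AE x in ?M. B (\<lambda>y. c * f y) x = c * B f x"
      using B f by (simp add: L2_bounded_operator_def)
    then have "l (\<lambda>x. c * f x) = L2_inner ?M (\<lambda>x. c * B f x) (B (exponential 0))"
      unfolding l_def by (intro L2_inner_cong_AE BL2 L2_cmult f exponential_L2)
    then show ?thesis
      by (simp add: l_def L2_inner_cmult_left)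
  qed
  have bound: "cmod (l f) \<le> (C * L2_norm ?M (B (exponential 0))) * L2_norm ?M f"
    if f: "f \<in> L2 ?M" for f
  proof -
    have "cmod (l f) \<le> L2_norm ?M (B f) * L2_norm ?M (B (exponential 0))"
      unfolding l_def by (intro L2_inner_Cauchy_Schwarz BL2 f B0)
    also have "\<dots> \<le> (C * L2_norm ?M f) * L2_norm ?M (B (exponential 0))"
      by (intro mult_right_mono C f) simp
    finally show ?thesis by (simp add: mult_ac)
  qed
  have l_lacunary: "l (lacunary k) = l (exponential (3 ^ k)) + (- cantor_fourier 1) * l (exponential 0)" for k
    unfolding lacunary_def
      add[OF exponential_L2[of "3 ^ k"] L2_cmult[OF exponential_L2[of 0], of "- cantor_fourier 1"]]
      cmult[OF exponential_L2[of 0]] ..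
  have "(\<lambda>k. l (exponential (3 ^ k))) \<longlonglongrightarrow> 0"
    using LIMSEQ_subseq_LIMSEQ[OF lim, of "\<lambda>k. 3 ^ k"]
    by (simp add: l_def comp_def strict_mono_def)
  then have lim': "(\<lambda>k. l (lacunary k)) \<longlonglongrightarrow> 0 + (- cantor_fourier 1) * l (exponential 0)"
    unfolding l_lacunary by (rule tendsto_add[OF _ tendsto_const])
  \<comment> \<open>The values on the exponentials tend to 0 by assumption, so only the centring
    constant survives in the limit. Near-orthogonality forces this limit to vanish too.\<close>
  have "0 + (- cantor_fourier 1) * l (exponential 0) = 0"
  proof (rule L2_bounded_functional_limit_eq_0[where M = ?M and l = l and v = lacunary and C = 1])
    show "l (\<lambda>x. f x + g x) = l f + l g" if "f \<in> L2 ?M" "g \<in> L2 ?M" for f g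
      using that by (rule add)
    show "cmod (l f) \<le> (C * L2_norm ?M (B (exponential 0))) * L2_norm ?M f" if "f \<in> L2 ?M" for f
      using that by (rule bound)
    show "lacunary k \<in> L2 ?M" "L2_norm ?M (lacunary k) \<le> 1" for k
      by (rule lacunary_L2 lacunary_norm_le)+
    show "\<exists>m. \<forall>d\<ge>m. \<forall>k. cmod (L2_inner ?M (lacunary (k + d)) (lacunary k)) \<le> e" if "e > 0" for e
      using that by (rule lacunary_almost_orthogonal)
    show "(\<lambda>k. l (lacunary k)) \<longlonglongrightarrow> 0 + (- cantor_fourier 1) * l (exponential 0)"
      by (rule lim')
  qed
  then have "l (exponential 0) = 0"
    using cantor_fourier_1_nonzero by simp
  then have "(LINT x|?M. (cmod (B (exponential 0) x))\<^sup>2) = 0"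
    unfolding l_def L2_inner_self L2_norm_power2 of_real_eq_0_iff .
  then have "AE x in ?M. (cmod (B (exponential 0) x))\<^sup>2 = 0"
    by (rule integral_nonneg_eq_0_iff_AE[OF L2_integrable_square[OF B0] AE_I2[OF zero_le_power2], THEN iffD1])
  then show ?thesis
    by eventually_elim simp
qed

text \<open>The squared moduli are the terms of a convergent series; swapping the two arguments only
  conjugates the inner product.\<close>

lemma L2_Bessel_sequence_inner_tendsto_0:
  assumes "L2_Bessel_sequence M F" "f \<in> L2 M"
  shows "(\<lambda>n. L2_inner M (F n) f) \<longlonglongrightarrow> 0"
proof -
  have "summable (\<lambda>n. (cmod (L2_inner M f (F n)))\<^sup>2)"
    using assms unfolding L2_Bessel_sequence_def by (elim conjE exE) (drule (1) bspec, erule conjunct1)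
  from tendsto_real_sqrt[OF summable_LIMSEQ_zero[OF this]]
  have "(\<lambda>n. cmod (L2_inner M f (F n))) \<longlonglongrightarrow> 0"
    by (simp only: real_sqrt_abs abs_norm_cancel real_sqrt_zero)
  moreover have "cmod (L2_inner M f (F n)) = cmod (L2_inner M (F n) f)" for n
    unfolding L2_inner_commute[of M f "F n"] complex_mod_cnj ..
  ultimately show ?thesis
    by (simp only: tendsto_norm_zero_iff)
qed

theorem corollary4p1:
  "\<not> (\<exists>B :: (real \<Rightarrow> complex) \<Rightarrow> (real \<Rightarrow> complex).
        L2_bounded_operator cantor_measure B \<and>
        L2_injective cantor_measure B \<and>
        L2_Bessel_sequence cantor_measure
          (\<lambda>n::nat. B (\<lambda>x. exp (2 * complex_of_real pi * \<i> * of_nat n * complex_of_real x))))"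
proof
  assume "\<exists>B :: (real \<Rightarrow> complex) \<Rightarrow> (real \<Rightarrow> complex).
        L2_bounded_operator cantor_measure B \<and>
        L2_injective cantor_measure B \<and>
        L2_Bessel_sequence cantor_measure
          (\<lambda>n::nat. B (\<lambda>x. exp (2 * complex_of_real pi * \<i> * of_nat n * complex_of_real x)))"
  moreover have "(\<lambda>x. exp (2 * complex_of_real pi * \<i> * of_nat n * complex_of_real x)) = exponential n" for n
    by (simp add: exponential_def cis_conv_exp mult_ac)
  ultimately obtain B :: "(real \<Rightarrow> complex) \<Rightarrow> (real \<Rightarrow> complex)" where
    B: "L2_bounded_operator cantor_measure B" and inj: "L2_injective cantor_measure B"
    and Bessel: "L2_Bessel_sequence cantor_measure (\<lambda>n. B (exponential n))"
    by auto
  have zero_L2: "(\<lambda>_. 0) \<in> L2 cantor_measure"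
    by (simp add: L2_def)
  have "B (exponential 0) \<in> L2 cantor_measure"
    using B exponential_L2 by (simp add: L2_bounded_operator_def)
  from L2_bounded_operator_exponential_0_eq_0[OF B L2_Bessel_sequence_inner_tendsto_0[OF Bessel this]]
  have "AE x in cantor_measure. B (exponential 0) x = 0" .
  \<comment> \<open>Homogeneity with the scalar 0 shows that \<open>B\<close> maps the zero function
    to zero almost everywhere. This puts the vanishing of \<open>B (exponential 0)\<close> into the
    form that injectivity compares.\<close>
  moreover have "\<forall>c. \<forall>f\<in>L2 cantor_measure. AE x in cantor_measure. B (\<lambda>y. c * f y) x = c * B f x"
    using B unfolding L2_bounded_operator_def by (elim conjE)
  from this[rule_format, OF zero_L2, of 0]
  have "AE x in cantor_measure. B (\<lambda>y. 0) x = 0"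
    by simp
  ultimately have "AE x in cantor_measure. B (exponential 0) x = B (\<lambda>_. 0) x"
    by eventually_elim simp
  then have "AE x in cantor_measure. exponential 0 x = 0"
    by (rule inj[unfolded L2_injective_def, rule_format, OF exponential_L2 zero_L2])
  \<comment> \<open>The constant 1 cannot vanish almost everywhere for a probability
    measure.\<close>
  then show False
    by (simp add: exponential_0 cantor_measure.AE_const)
qed

end
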